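(* Let $x,y$ be nonzero vectors of $\mathbb R^3$ satisfying $x\cdot y=0$. The translation of $\mathbb R^3$ by the vector $x$ is induced by the composition of the four reflections in $\mathbb R^{3,3}$ with respect to the following invertible vectors, applied sequentially from right to left: $$\begin{pmatrix} y \\ -y+\frac{x\times y}{2} \end{pmatrix},\quad \begin{pmatrix} y \\ y+\frac{x\times y}{2} \end{pmatrix},\quad \begin{pmatrix} y \\ -y \end{pmatrix},\quad \begin{pmatrix} y \\ y \end{pmatrix}.$$
   Context: Let $e_0,e_1,e_2,e_3$ be the standard orthonormal basis of $\mathbb R^4$ and identify $\mathbb R^3=\mathrm{span}(e_1,e_2,e_3)$. $\mathbb R^{3,3}=\Lambda^2(\mathbb R^4)$ has basis $E_i=e_0\wedge e_i$ ($i=1,2,3$), $E_1'=e_2\wedge e_3$, $E_2'=e_3\wedge e_1$, $E_3'=e_1\wedge e_2$ and symmetric bilinear form $E_i\cdot E_j'=\delta_{ij}$, $E_i\cdot E_j=E_i'\cdot E_j'=0$. For $x,y\in\mathbb R^3$, $\begin{pmatrix} x \\ y \end{pmatrix}$ denotes the vector $\sum_i x_iE_i+\sum_i y_iE_i'$ of $\mathbb R^{3,3}$; it is invertible iff $x\cdot y\ne0$. The reflection with respect to an invertible $U\in\mathbb R^{3,3}$ is $V\mapsto V-2\frac{V\cdot U}{U\cdot U}U$. A linear isometry $g$ of $\mathbb R^{3,3}$ induces the map $p\mapsto Rp+t$ of $\mathbb R^3$ (matrix $A=\begin{pmatrix} 1 & 0 \\ t & R \end{pmatrix}$ on $\mathbb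 R^4$ in the basis $e_0,\dots,e_3$) if for every nonzero $X\in\mathbb R^4$, $g$ maps the null 3-space $\{X\wedge Y:Y\in\mathbb R^4\}$ to $\{AX\wedge Y:Y\in\mathbb R^4\}$. *)

theory Defs
  imports "HOL-Analysis.Analysis"
begin

text \<open>
  \<open>\<real>\<^sup>4\<close> is \<^typ>\<open>real^4\<close>, where \<open>axis 0 1, axis 1 1, axis 2 1, axis 3 1\<close> play the role of
  \<open>e\<^sub>0, e\<^sub>1, e\<^sub>2, e\<^sub>3\<close> (in the index type \<^typ>\<open>4\<close> we have \<open>4 = 0\<close>).
  \<open>\<real>\<^bsup>3,3\<^esup> = \<Lambda>\<^sup>2(\<real>\<^sup>4)\<close> is given by coordinates in the basis
  \<open>E\<^sub>1, E\<^sub>2, E\<^sub>3, E'\<^sub>1, E'\<^sub>2, E'\<^sub>3\<close>: the pair \<open>(x, y)\<close> is the vector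
  \<open>\<Sum>\<^sub>i x\<^sub>i E\<^sub>i + \<Sum>\<^sub>i y\<^sub>i E'\<^sub>i\<close>. The lemmas below show that \<open>wedge\<close> makes this space
  the second exterior power of \<open>\<real>\<^sup>4\<close>.
\<close>

type_synonym R33 = "(real^3) \<times> (real^3)"

definition wedge :: "real^4 \<Rightarrow> real^4 \<Rightarrow> R33" where
  "wedge X Y =
    (vector [X$0 * Y$1 - X$1 * Y$0, X$0 * Y$2 - X$2 * Y$0, X$0 * Y$3 - X$3 * Y$0],
     vector [X$2 * Y$3 - X$3 * Y$2, X$3 * Y$1 - X$1 * Y$3, X$1 * Y$2 - X$2 * Y$1])"

text \<open>
  This is \<open>E\<^sub>i \<cdot> E'\<^sub>j = \<delta>\<^sub>i\<^sub>j\<close>, \<open>E\<^sub>i \<cdot> E\<^sub>j = E'\<^sub>i \<cdot> E'\<^sub>j = 0\<close>, extended bilinearly;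
  it is not the Euclidean inner product of the product type.
\<close>

definition form33 :: "R33 \<Rightarrow> R33 \<Rightarrow> real" where
  "form33 U V = fst U \<bullet> snd V + snd U \<bullet> fst V"

definition invertible33 :: "R33 \<Rightarrow> bool" where
  "invertible33 U \<longleftrightarrow> fst U \<bullet> snd U \<noteq> 0"

definition reflection33 :: "R33 \<Rightarrow> R33 \<Rightarrow> R33" where
  "reflection33 U V = V - (2 * (form33 V U / form33 U U)) *\<^sub>R U"

definition linear_isometry33 :: "(R33 \<Rightarrow> R33) \<Rightarrow> bool" where
  "linear_isometry33 g \<longleftrightarrow> linear g \<and> (\<forall>U V. form33 (g U) (g V) = form33 U V)"

definition null_space33 :: "real^4 \<Rightarrow> R33 set" where
  "null_space33 X = {wedge X Y | Y. True}"

definition idx3 :: "4 \<Rightarrow> 3" where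
  "idx3 i = (if i = 1 then 1 else if i = 2 then 2 else 3)"

text \<open>The block matrix with rows \<open>(1, 0)\<close> and \<open>(t, R)\<close>; \<open>idx3\<close> is only used at \<open>1, 2, 3\<close>.\<close>

definition affine_matrix :: "real^3^3 \<Rightarrow> real^3 \<Rightarrow> real^4^4" where
  "affine_matrix R t = (\<chi> i j.
     if i = 0 then (if j = 0 then 1 else 0)
     else if j = 0 then t $ idx3 i
     else R $ idx3 i $ idx3 j)"

text \<open>The affine map \<open>f\<close> determines \<open>R\<close> and \<open>t\<close> uniquely.\<close>

definition induces :: "(R33 \<Rightarrow> R33) \<Rightarrow> (real^3 \<Rightarrow> real^3) \<Rightarrow> bool" where
  "induces g f \<longleftrightarrow> linear_isometry33 g \<and>
     (\<exists>R t. (\<forall>p. f p = R *v p + t) \<and>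
        (\<forall>X. X \<noteq> 0 \<longrightarrow> g ` null_space33 X = null_space33 (affine_matrix R t *v X)))"

lemma form33_self: "form33 U U = 2 * (fst U \<bullet> snd U)"
  by (simp add: form33_def inner_commute)

lemma exhaust_idx4:
  fixes i :: 4
  shows "i = 0 \<or> i = 1 \<or> i = 2 \<or> i = 3"
  using exhaust_4[of i] by auto

lemma vec4_expand:
  fixes X :: "real^4"
  shows "X = X$0 *\<^sub>R axis 0 1 + X$1 *\<^sub>R axis 1 1 + X$2 *\<^sub>R axis 2 1 + X$3 *\<^sub>R axis 3 1"
  unfolding vec_eq_iff
proof
  fix i :: 4
  show "X$i = (X$0 *\<^sub>R axis 0 1 + X$1 *\<^sub>R axis 1 1 + X$2 *\<^sub>R axis 2 1 + X$3 *\<^sub>R axis 3 1) $ i"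
    using exhaust_idx4[of i] by (auto simp: axis_def)
qed

lemma wedge_basis:
  "wedge (axis 0 1) (axis 1 1) = (axis 1 1, 0)"
  "wedge (axis 0 1) (axis 2 1) = (axis 2 1, 0)"
  "wedge (axis 0 1) (axis 3 1) = (axis 3 1, 0)"
  "wedge (axis 2 1) (axis 3 1) = (0, axis 1 1)"
  "wedge (axis 3 1) (axis 1 1) = (0, axis 2 1)"
  "wedge (axis 1 1) (axis 2 1) = (0, axis 3 1)"
  by (auto simp: wedge_def vec_eq_iff forall_3 axis_def)

lemma bilinear_wedge: "bilinear wedge"
  unfolding bilinear_def
  by (auto intro!: linearI simp: wedge_def vec_eq_iff forall_3 algebra_simps)

lemma wedge_self: "wedge X X = 0"
  by (auto simp: wedge_def vec_eq_iff forall_3 zero_prod_def)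

lemma R33_expand:
  fixes U :: R33
  shows "U = fst U $ 1 *\<^sub>R (axis 1 1, 0) + fst U $ 2 *\<^sub>R (axis 2 1, 0) + fst U $ 3 *\<^sub>R (axis 3 1, 0)
           + snd U $ 1 *\<^sub>R (0, axis 1 1) + snd U $ 2 *\<^sub>R (0, axis 2 1) + snd U $ 3 *\<^sub>R (0, axis 3 1)"
  by (auto simp: prod_eq_iff vec_eq_iff forall_3 axis_def)

lemma wedge_universal:
  fixes B :: "real^4 \<Rightarrow> real^4 \<Rightarrow> 'a::real_vector"
  assumes B: "bilinear B" and alt: "\<And>X. B X X = 0"
  shows "\<exists>!f. linear f \<and> (\<forall>X Y. f (wedge X Y) = B X Y)"
proof -
  define e :: "4 \<Rightarrow> real^4" where "e = (\<lambda>i. axis i 1)"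
  have anti: "B X Y = - B Y X" for X Y
  proof -
    have "B (X + Y) (X + Y) = B X X + B X Y + (B Y X + B Y Y)"
      using B by (simp add: bilinear_ladd bilinear_radd)
    then show ?thesis by (simp add: alt eq_neg_iff_add_eq_0)
  qed
  define f where "f = (\<lambda>U::R33.
      fst U $ 1 *\<^sub>R B (e 0) (e 1) + fst U $ 2 *\<^sub>R B (e 0) (e 2) + fst U $ 3 *\<^sub>R B (e 0) (e 3)
    + snd U $ 1 *\<^sub>R B (e 2) (e 3) + snd U $ 2 *\<^sub>R B (e 3) (e 1) + snd U $ 3 *\<^sub>R B (e 1) (e 2))"
  have lin: "linear f"
    by (auto intro!: linearI simp: f_def algebra_simps)
  have ext: "f (wedge X Y) = B X Y" for X Y
  proof -
    have X: "X = X$0 *\<^sub>R e 0 + X$1 *\<^sub>R e 1 + X$2 *\<^sub>R e 2 + X$3 *\<^sub>R e 3"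
      and Y: "Y = Y$0 *\<^sub>R e 0 + Y$1 *\<^sub>R e 1 + Y$2 *\<^sub>R e 2 + Y$3 *\<^sub>R e 3"
      unfolding e_def by (rule vec4_expand)+
    have "B X Y = B (X$0 *\<^sub>R e 0 + X$1 *\<^sub>R e 1 + X$2 *\<^sub>R e 2 + X$3 *\<^sub>R e 3)
                    (Y$0 *\<^sub>R e 0 + Y$1 *\<^sub>R e 1 + Y$2 *\<^sub>R e 2 + Y$3 *\<^sub>R e 3)"
      using X Y by simp
    also have "\<dots> = f (wedge X Y)"
      using anti[of "e 1" "e 0"] anti[of "e 2" "e 0"] anti[of "e 3" "e 0"]
        anti[of "e 3" "e 2"] anti[of "e 1" "e 3"] anti[of "e 2" "e 1"]
      by (simp add: bilinear_ladd[OF B] bilinear_radd[OF B] bilinear_lmul[OF B] bilinear_rmul[OF B]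
          alt f_def wedge_def algebra_simps)
    finally show ?thesis by simp
  qed
  have uniq: "h = f" if h: "linear h" "\<And>X Y. h (wedge X Y) = B X Y" for h
  proof
    fix U :: R33
    have "h U = f U" if "\<And>V. V \<in> {(axis 1 1, 0), (axis 2 1, 0), (axis 3 1, 0),
        (0, axis 1 1), (0, axis 2 1), (0, axis 3 1)} \<Longrightarrow> h V = f V"
      using that
      by (subst (1 2) R33_expand) (simp add: linear_add[OF h(1)] linear_add[OF lin]
          linear_scale[OF h(1)] linear_scale[OF lin] del: scaleR_Pair)
    moreover have "h V = f V" if "V \<in> {(axis 1 1, 0), (axis 2 1, 0), (axis 3 1, 0),
        (0, axis 1 1), (0, axis 2 1), (0, axis 3 1)}" for V
    proof -
      obtain X Y where "V = wedge X Y"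
        using \<open>V \<in> _\<close> wedge_basis by (metis insertE emptyE)
      then show ?thesis by (simp add: h(2) ext)
    qed
    ultimately show "h U = f U" by blast
  qed
  show ?thesis
    using lin ext uniq by blast
qed

end

theory Submission
  imports Defs
begin

text \<open>
  Put \<open>z = (x \<times> y)/2\<close>, which is orthogonal to \<open>y\<close>. The vectors \<open>(y, y + z)\<close> and \<open>(y, -y + z)\<close>
  are orthogonal for the form on \<open>\<real>\<^bsup>3,3\<^esup>\<close>, so the composition of their reflections subtracts the
  two projections independently. Composing the map so obtained with its special case \<open>z = 0\<close>
  gives \<open>(a, b) \<mapsto> (a, b + x \<times> a)\<close>, and \<open>x \<times> a\<close> is exactly what the translation
  \<open>X \<mapsto> X + X\<^sub>0 x\<close> adds to the second component of \<open>X \<and> Y\<close>.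
\<close>

text \<open>Subtracting a multiple of \<open>W\<close> from \<open>V\<close> does not change
  \<open>form33 V U\<close>, so the outer reflection subtracts the same multiple of \<open>U\<close>
  as it would from \<open>V\<close> itself.\<close>

lemma reflection33_comp_orthogonal:
  assumes "form33 U W = 0"
  shows "reflection33 U (reflection33 W V) =
    V - (2 * (form33 V U / form33 U U)) *\<^sub>R U - (2 * (form33 V W / form33 W W)) *\<^sub>R W"
proof -
  have "form33 (V - c *\<^sub>R W) U = form33 V U" for c
    using assms by (simp add: form33_def inner_diff_left inner_commute algebra_simps
        flip: distrib_left)
  then show ?thesis
    by (simp add: reflection33_def)
qed

lemma reflection33_pair:
  fixes y z a b :: "real^3"
  assumes "y \<noteq> 0" and "y \<bullet> z = 0"
  shows "reflection33 (y, - y + z) (reflection33 (y, y + z) (a, b)) =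
    (a - (2 * (a \<bullet> y) / (y \<bullet> y)) *\<^sub>R y,
     b - (2 / (y \<bullet> y)) *\<^sub>R ((a \<bullet> y) *\<^sub>R z + (a \<bullet> z + b \<bullet> y) *\<^sub>R y))"
proof -
  define n where "n = y \<bullet> y"
  \<comment> \<open>The multiples of \<open>(y, - y + z)\<close> and \<open>(y, y + z)\<close> that
    get subtracted are \<open>p - q\<close> and \<open>p + q\<close>. Their sum \<open>2 * p\<close>
    multiplies \<open>y\<close> in the first component and \<open>z\<close> in the second, their
    difference \<open>2 * q\<close> multiplies \<open>y\<close> in the second.\<close>
  define p where "p = a \<bullet> y / n"
  define q where "q = (a \<bullet> z + b \<bullet> y) / n"
  have n: "n \<noteq> 0"
    using assms(1) by (simp add: n_def)
  have "form33 (y, - y + z) (y, y + z) = 0"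
    using assms(2) by (simp add: form33_def inner_add_left inner_add_right inner_diff_left inner_diff_right
        inner_commute)
  note * = reflection33_comp_orthogonal[OF this]
  have c1: "2 * (form33 (a, b) (y, - y + z) / form33 (y, - y + z) (y, - y + z)) = p - q"
    using n assms(2) by (simp add: form33_self n_def[symmetric] p_def q_def)
      (simp add: form33_def inner_diff_right inner_add_right n_def[symmetric] field_simps)
  have c2: "2 * (form33 (a, b) (y, y + z) / form33 (y, y + z) (y, y + z)) = p + q"
    using n assms(2)
    by (simp add: form33_def inner_add_left inner_add_right inner_commute n_def[symmetric]
        p_def q_def field_simps)
  have p: "2 * (a \<bullet> y) / n = 2 * p" "(2 / n) * (a \<bullet> y) = 2 * p"
    and q: "(2 / n) * (a \<bullet> z + b \<bullet> y) = 2 * q"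
    by (simp_all add: p_def q_def)
  show ?thesis
    unfolding * c1 c2 n_def[symmetric] scaleR_add_right scaleR_scaleR p q
    by (simp add: vec_eq_iff algebra_simps)
qed

lemma reflection33_four:
  fixes x y :: "real^3"
  assumes "y \<noteq> 0" and "x \<bullet> y = 0"
  shows "reflection33 (y, - y + (1/2) *\<^sub>R cross3 x y)
           (reflection33 (y, y + (1/2) *\<^sub>R cross3 x y)
             (reflection33 (y, - y) (reflection33 (y, y) (a, b)))) = (a, b + cross3 x a)"
proof -
  define z where "z = (1/2) *\<^sub>R cross3 x y"
  define n where "n = y \<bullet> y"
  have n: "n \<noteq> 0"
    using assms(1) by (simp add: n_def)
  have yz: "y \<bullet> z = 0" "z \<bullet> y = 0"
    by (simp_all add: z_def dot_cross_self)
  \<comment> \<open>The inner pair reflects both components in the plane orthogonal to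
    \<open>y\<close>. The outer pair does this again, which cancels it, and leaves only the terms
    that contain \<open>z\<close>.\<close>
  define a' where "a' = a - (2 * (a \<bullet> y) / n) *\<^sub>R y"
  define b' where "b' = b - (2 * (b \<bullet> y) / n) *\<^sub>R y"
  have first: "reflection33 (y, - y) (reflection33 (y, y) (a, b)) = (a', b')"
    using reflection33_pair[OF assms(1), of 0 a b] by (simp add: a'_def b'_def n_def)
  have a'y: "a' \<bullet> y = - (a \<bullet> y)" and b'y: "b' \<bullet> y = - (b \<bullet> y)" and a'z: "a' \<bullet> z = a \<bullet> z"
    using n yz by (simp_all add: a'_def b'_def inner_diff_left n_def[symmetric])
  \<comment> \<open>The left side is the expansion of a double cross product whose inner factor
    \<open>cross3 z y\<close> is a multiple of \<open>x\<close>, because \<open>x\<close> is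
    orthogonal to \<open>y\<close>.\<close>
  have "(a \<bullet> y) *\<^sub>R z - (a \<bullet> z) *\<^sub>R y = (n / 2) *\<^sub>R cross3 x a"
  proof -
    have "(a \<bullet> y) *\<^sub>R z - (a \<bullet> z) *\<^sub>R y = cross3 a (cross3 z y)"
      by (simp add: Lagrange)
    also have "cross3 z y = - (n / 2) *\<^sub>R x"
    proof -
      have "cross3 (cross3 x y) y = - cross3 y (cross3 x y)"
        by (rule cross_skew)
      also have "\<dots> = - n *\<^sub>R x"
        using assms(2) by (simp add: Lagrange n_def inner_commute)
      finally show ?thesis
        by (simp add: z_def cross_mult_left)
    qed
    finally show ?thesis
      by (simp add: cross_mult_right cross_skew[of a x])
  qed
  then have cr: "cross3 x a = (2 / n) *\<^sub>R ((a \<bullet> y) *\<^sub>R z - (a \<bullet> z) *\<^sub>R y)"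
    using n by simp
  show ?thesis
    unfolding z_def[symmetric] first reflection33_pair[OF assms(1) yz(1)] n_def[symmetric]
      a'y b'y a'z cr
    by (simp add: a'_def b'_def algebra_simps)
qed

lemma affine_matrix_one_mult:
  "affine_matrix (mat 1) t *v X =
    (\<chi> i. if i = 0 then X $ 0 else X $ i + X $ 0 * t $ idx3 i)"
proof -
  \<comment> \<open>\<open>sum_4\<close> runs over the indices 1 to 4, and the last of them is the
    index 0 of the homogeneous coordinate.\<close>
  have four: "(4::4) = 0"
    by simp
  have "(affine_matrix (mat 1) t *v X) $ i =
      (if i = 0 then X $ 0 else X $ i + X $ 0 * t $ idx3 i)" for i
    using exhaust_idx4[of i]
    by (auto simp: affine_matrix_def matrix_vector_mult_def mat_def idx3_def sum_4 four)
  then show ?thesis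
    by (simp add: vec_eq_iff)
qed

text \<open>The second component of a wedge is the cross product of the spatial parts. Expanding it
  for the translated vectors, the term with \<open>t\<close> twice vanishes and the two mixed terms
  combine to \<open>t\<close> crossed with the first component.\<close>

lemma wedge_affine_matrix_one:
  "wedge (affine_matrix (mat 1) t *v X) (affine_matrix (mat 1) t *v Y) =
    (fst (wedge X Y), snd (wedge X Y) + cross3 t (fst (wedge X Y)))"
  by (simp add: affine_matrix_one_mult wedge_def vec_eq_iff forall_3 cross3_def idx3_def
      algebra_simps)

text \<open>Needed so that the images of all \<open>Y\<close> fill the whole null space of the
  translated point; the preimage comes from the opposite translation.\<close>

lemma surj_affine_matrix_one: "surj ((*v) (affine_matrix (mat 1) t))"
proof
  show "UNIV \<subseteq> range ((*v) (affine_matrix (mat 1) t))"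
  proof
    fix Y :: "real^4"
    have "Y = affine_matrix (mat 1) t *v (affine_matrix (mat 1) (- t) *v Y)"
      by (simp add: affine_matrix_one_mult vec_eq_iff)
    then show "Y \<in> range ((*v) (affine_matrix (mat 1) t))"
      by blast
  qed
qed simp

text \<open>The form is preserved because crossing with \<open>x\<close> is a skew-symmetric
  operator, so the two added terms cancel.\<close>

lemma linear_isometry33_shear: "linear_isometry33 (\<lambda>(a, b). (a, b + cross3 x a))"
proof -
  have "linear (\<lambda>(a, b). (a, b + cross3 x a))"
    by (auto intro!: linearI simp: cross_add_right cross_mult_right algebra_simps)
  moreover have "a \<bullet> cross3 x c + cross3 x a \<bullet> c = 0" for a c
    by (simp add: cross3_def inner_vec_def sum_3 algebra_simps)
  then have "form33 (a, b + cross3 x a) (c, d + cross3 x c) = form33 (a, b) (c, d)" for a b c d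
    by (simp add: form33_def inner_add_left inner_add_right algebra_simps)
  ultimately show ?thesis
    by (auto simp: linear_isometry33_def)
qed

lemma induces_translation: "induces (\<lambda>(a, b). (a, b + cross3 x a)) (\<lambda>p. p + x)"
proof -
  let ?A = "affine_matrix (mat 1) x"
  have "(\<lambda>(a, b). (a, b + cross3 x a)) ` null_space33 X = null_space33 (?A *v X)" for X
  proof -
    have "(\<lambda>(a, b). (a, b + cross3 x a)) ` null_space33 X = range (\<lambda>Y. wedge (?A *v X) (?A *v Y))"
      by (simp add: null_space33_def wedge_affine_matrix_one full_SetCompr_eq image_image
          case_prod_beta)
    also have "\<dots> = wedge (?A *v X) ` range ((*v) ?A)"
      by (simp add: image_image)
    also have "\<dots> = null_space33 (?A *v X)"
      by (auto simp: null_space33_def surj_affine_matrix_one)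
    finally show ?thesis .
  qed
  then have "\<exists>R t. (\<forall>p. p + x = R *v p + t) \<and>
      (\<forall>X. X \<noteq> 0 \<longrightarrow> (\<lambda>(a, b). (a, b + cross3 x a)) ` null_space33 X =
        null_space33 (affine_matrix R t *v X))"
    by (intro exI[of _ "mat 1"] exI[of _ x]) simp
  then show ?thesis
    by (simp add: induces_def linear_isometry33_shear)
qed

theorem proposition27:
  fixes x y :: "real^3"
  assumes "x \<noteq> 0" and "y \<noteq> 0" and "x \<bullet> y = 0"
  shows "invertible33 (y, - y + (1/2) *\<^sub>R cross3 x y)
       \<and> invertible33 (y, y + (1/2) *\<^sub>R cross3 x y)
       \<and> invertible33 (y, - y)
       \<and> invertible33 (y, y)
       \<and> induces
           (reflection33 (y, - y + (1/2) *\<^sub>R cross3 x y)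
            \<circ> reflection33 (y, y + (1/2) *\<^sub>R cross3 x y)
            \<circ> reflection33 (y, - y)
            \<circ> reflection33 (y, y))
           (\<lambda>p. p + x)"
proof -
  have "reflection33 (y, - y + (1/2) *\<^sub>R cross3 x y) \<circ> reflection33 (y, y + (1/2) *\<^sub>R cross3 x y)
      \<circ> reflection33 (y, - y) \<circ> reflection33 (y, y) = (\<lambda>(a, b). (a, b + cross3 x a))"
    using reflection33_four[OF assms(2,3)] by auto
  \<comment> \<open>Invertibility holds since \<open>cross3 x y\<close> is orthogonal to
    \<open>y\<close>, so each product of components is \<open>y \<bullet> y\<close> up to
    sign.\<close>
  then show ?thesis
    using assms(2) induces_translation[of x]
    by (simp add: invertible33_def inner_diff_right inner_add_right dot_cross_self)
qed

end
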